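(* Let $G_1$ and $G_2$ be finite groups, let $\mathcal{D}$ be a collection of $G_1$, and let $f: G_1 \to G_2$ be a surjective group homomorphism. Put $\mathcal{D}_{\ker f} = \{H \in \mathcal{D} \mid \ker f \leq H\}$ and $f(\mathcal{D}_{\ker f}) = \{f(H) \leq G_2 \mid H \in \mathcal{D},\ \ker f \leq H\}$. Then there is a ring isomorphism $$\Omega(G_1, \mathcal{D}_{\ker f}) \simeq \Omega(G_2, f(\mathcal{D}_{\ker f})).$$
   Context: For a finite group $G$, the Burnside ring $\Omega(G)$ is the Grothendieck ring of the semiring of isomorphism classes of finite left $G$-sets, with addition given by disjoint union and multiplication by Cartesian product. It is a free abelian group with basis the classes $[G/H]$, where $H$ runs over representatives of the conjugacy classes of subgroups of $G$. A collection of $G$ is a family $\mathcal{D}$ of subgroups of $G$ with $G \in \mathcal{D}$ that is closed under $G$-conjugation and under intersection of two members. For a collection $\mathcal{D}$ of $G$, the partial Burnside ring $\Omega(G,\mathcal{D})$ is the $\mathbb{Z}$-span of $\{[G/H] \mid H \in \mathcal{D}\}$ in $\Omega(G)$; it is a unital subring of $\Omega(G)$. (Both $\mathcal{D}_{\ker f}$ and $f(\mathcal{D}_{\ker f})$ are collections, of $G_1$ and $G_2$ respectively.) *)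

theory Defs
  imports "HOL-Algebra.Group_Action" "HOL-Algebra.Left_Coset" "HOL-Algebra.QuotRing" "HOL-Algebra.Generated_Groups"
begin

section \<open>Finite G-sets\<close>

text \<open>
  A left G-set is a pair of its underlying set and its action, the action being a
  homomorphism into the symmetric group of that set as in locale \<^locale>\<open>group_action\<close>.
\<close>

type_synonym ('a, 'b) gset = "'b set \<times> ('a \<Rightarrow> 'b \<Rightarrow> 'b)"

definition finite_gset :: "('a, 'm) monoid_scheme \<Rightarrow> ('a, 'b) gset \<Rightarrow> bool" where
  "finite_gset G X \<longleftrightarrow> finite (fst X) \<and> group_action G (fst X) (snd X)"

definition gset_iso ::
    "('a, 'm) monoid_scheme \<Rightarrow> ('a, 'b) gset \<Rightarrow> ('a, 'c) gset \<Rightarrow> bool" where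
  "gset_iso G X Y \<longleftrightarrow> (\<exists>h. bij_betw h (fst X) (fst Y) \<and>
     (\<forall>g \<in> carrier G. \<forall>x \<in> fst X. h (snd X g x) = snd Y g (h x)))"

text \<open>The restrictions make the actions extensional, as \<^const>\<open>BijGroup\<close> demands.\<close>

definition gset_sum :: "('a, 'b) gset \<Rightarrow> ('a, 'c) gset \<Rightarrow> ('a, 'b + 'c) gset" where
  "gset_sum X Y =
     (Sum_Type.Plus (fst X) (fst Y),
      \<lambda>g. restrict (map_sum (snd X g) (snd Y g)) (Sum_Type.Plus (fst X) (fst Y)))"

definition gset_prod :: "('a, 'b) gset \<Rightarrow> ('a, 'c) gset \<Rightarrow> ('a, 'b \<times> 'c) gset" where
  "gset_prod X Y =
     (fst X \<times> fst Y, \<lambda>g. restrict (map_prod (snd X g) (snd Y g)) (fst X \<times> fst Y))"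

definition empty_gset :: "('a, unit) gset" where
  "empty_gset = ({}, \<lambda>g. restrict id {})"

definition point_gset :: "('a, unit) gset" where
  "point_gset = ({()}, \<lambda>g. restrict id {()})"

definition coset_gset :: "('a, 'm) monoid_scheme \<Rightarrow> 'a set \<Rightarrow> ('a, 'a set) gset" where
  "coset_gset G H = (lcosets\<^bsub>G\<^esub> H, \<lambda>g. \<lambda>C \<in> lcosets\<^bsub>G\<^esub> H. g <#\<^bsub>G\<^esub> C)"


section \<open>The semiring of isomorphism classes\<close>

text \<open>
  HOL has no set of all finite G-sets across types.  Since every finite set is in bijection
  with a set of natural numbers, the class of a finite G-set over any type is represented by
  the nonempty set of all G-sets isomorphic to it whose elements are natural numbers.
\<close>

definition gset_class ::
    "('a, 'm) monoid_scheme \<Rightarrow> ('a, 'b) gset \<Rightarrow> ('a, nat) gset set" where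
  "gset_class G X = {Y. finite_gset G Y \<and> gset_iso G X Y}"

definition gset_semiring :: "('a, 'm) monoid_scheme \<Rightarrow> ('a, nat) gset set ring" where
  "gset_semiring G =
     \<lparr>carrier = {gset_class G X | X :: ('a, nat) gset. finite_gset G X},
      monoid.mult = (\<lambda>A B. \<Union>X \<in> A. \<Union>Y \<in> B. gset_class G (gset_prod X Y)),
      one = gset_class G point_gset,
      zero = gset_class G empty_gset,
      add = (\<lambda>A B. \<Union>X \<in> A. \<Union>Y \<in> B. gset_class G (gset_sum X Y))\<rparr>"


section \<open>The Grothendieck ring of a commutative semiring\<close>

text \<open>
  The pair (a, b) stands for the formal difference of a and b.  The auxiliary summand e is
  needed because the semiring is not assumed to be cancellative.
\<close>

definition grothendieck_rel :: "('c, 'm) ring_scheme \<Rightarrow> (('c \<times> 'c) \<times> ('c \<times> 'c)) set" where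
  "grothendieck_rel R =
     {((a, b), (c, d)). a \<in> carrier R \<and> b \<in> carrier R \<and> c \<in> carrier R \<and> d \<in> carrier R \<and>
        (\<exists>e \<in> carrier R. a \<oplus>\<^bsub>R\<^esub> d \<oplus>\<^bsub>R\<^esub> e = c \<oplus>\<^bsub>R\<^esub> b \<oplus>\<^bsub>R\<^esub> e)}"

definition grothendieck_class ::
    "('c, 'm) ring_scheme \<Rightarrow> 'c \<Rightarrow> 'c \<Rightarrow> ('c \<times> 'c) set" where
  "grothendieck_class R a b = grothendieck_rel R `` {(a, b)}"

definition grothendieck_ring :: "('c, 'm) ring_scheme \<Rightarrow> ('c \<times> 'c) set ring" where
  "grothendieck_ring R =
     \<lparr>carrier = (carrier R \<times> carrier R) // grothendieck_rel R,
      monoid.mult = (\<lambda>U V. \<Union>(a, b) \<in> U. \<Union>(c, d) \<in> V.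
        grothendieck_class R (a \<otimes>\<^bsub>R\<^esub> c \<oplus>\<^bsub>R\<^esub> b \<otimes>\<^bsub>R\<^esub> d) (a \<otimes>\<^bsub>R\<^esub> d \<oplus>\<^bsub>R\<^esub> b \<otimes>\<^bsub>R\<^esub> c)),
      one = grothendieck_class R \<one>\<^bsub>R\<^esub> \<zero>\<^bsub>R\<^esub>,
      zero = grothendieck_class R \<zero>\<^bsub>R\<^esub> \<zero>\<^bsub>R\<^esub>,
      add = (\<lambda>U V. \<Union>(a, b) \<in> U. \<Union>(c, d) \<in> V.
        grothendieck_class R (a \<oplus>\<^bsub>R\<^esub> c) (b \<oplus>\<^bsub>R\<^esub> d))\<rparr>"


section \<open>Burnside rings and partial Burnside rings\<close>

definition burnside_ring ::
    "('a, 'm) monoid_scheme \<Rightarrow> (('a, nat) gset set \<times> ('a, nat) gset set) set ring" where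
  "burnside_ring G = grothendieck_ring (gset_semiring G)"

definition burnside_class ::
    "('a, 'm) monoid_scheme \<Rightarrow> ('a, 'b) gset \<Rightarrow>
     (('a, nat) gset set \<times> ('a, nat) gset set) set" where
  "burnside_class G X =
     grothendieck_class (gset_semiring G) (gset_class G X) \<zero>\<^bsub>gset_semiring G\<^esub>"

definition collection :: "('a, 'm) monoid_scheme \<Rightarrow> 'a set set \<Rightarrow> bool" where
  "collection G D \<longleftrightarrow>
     (\<forall>H \<in> D. subgroup H G) \<and>
     carrier G \<in> D \<and>
     (\<forall>H \<in> D. \<forall>g \<in> carrier G. g <#\<^bsub>G\<^esub> H #>\<^bsub>G\<^esub> inv\<^bsub>G\<^esub> g \<in> D) \<and>
     (\<forall>H \<in> D. \<forall>K \<in> D. H \<inter> K \<in> D)"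

text \<open>
  The integer span of a subset of an abelian group is the additive subgroup it generates.
  The ring operations and the unit are those of the Burnside ring.
\<close>

definition partial_burnside_ring ::
    "('a, 'm) monoid_scheme \<Rightarrow> 'a set set \<Rightarrow>
     (('a, nat) gset set \<times> ('a, nat) gset set) set ring" where
  "partial_burnside_ring G D =
     (burnside_ring G)
       \<lparr>carrier := generate (add_monoid (burnside_ring G))
                    {burnside_class G (coset_gset G H) | H. H \<in> D}\<rparr>"

definition collection_above :: "'a set set \<Rightarrow> 'a set \<Rightarrow> 'a set set" where
  "collection_above D N = {H \<in> D. N \<subseteq> H}"

end

theory Submission
  imports Defs
begin

text \<open>
  A \<open>G2\<close>-set becomes a \<open>G1\<close>-set by letting \<open>g\<close> act as \<open>f g\<close>.  This inflation changes neither
  the underlying set nor any of the operations on it, so it respects disjoint unions and products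
  and induces a ring homomorphism from the Burnside ring of \<open>G2\<close> to that of \<open>G1\<close>
  (\<open>inflate_burnside_ring_hom\<close>).  When \<open>f\<close> is onto and \<open>H\<close> contains the kernel \<open>N\<close> of \<open>f\<close>, taking
  images under \<open>f\<close> is a bijection from the left cosets of \<open>H\<close> to those of \<open>f H\<close>, because a coset of
  \<open>H\<close> is a union of fibres of \<open>f\<close>.  Hence the inflation of \<open>G2/f H\<close> is \<open>G1/H\<close>
  (\<open>gset_iso_inflate_coset_gset\<close>): the homomorphism carries the generators of the partial Burnside
  ring of \<open>G2\<close> onto those of the partial Burnside ring of \<open>G1\<close>, and therefore the one subring onto
  the other.

  What remains is injectivity (\<open>inj_on_inflate_burnside\<close>).  Two inflated sets \<open>X\<close> and \<open>Y\<close> have equal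
  classes in the Burnside ring of \<open>G1\<close> as soon as \<open>X + E\<close> and \<open>Y + E\<close> are isomorphic for some
  \<open>G1\<close>-set \<open>E\<close>, which need not be inflated.  Passing to the points fixed by \<open>N\<close> repairs this: these
  points form a \<open>G2\<close>-set, functorially and compatibly with disjoint unions, and every point of
  an inflated set is fixed.  So \<open>X\<close> and \<open>Y\<close> become isomorphic over \<open>G2\<close> after adding the fixed points
  of \<open>E\<close> to both, which is exactly equality of their classes in the Burnside ring of \<open>G2\<close>.  This
  argument avoids the cancellation theorem for finite G-sets and with it the table of marks.
\<close>


section \<open>Finite G-sets and their isomorphisms\<close>

text \<open>
  The action laws already make every element act bijectively, with the inverse element providing the
  inverse map.  This criterion is how all G-sets below are recognised.
\<close>

lemma finite_gsetI:
  fixes G (structure)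
  assumes "group G" and "finite (fst X)"
    and closed: "\<And>g x. g \<in> carrier G \<Longrightarrow> x \<in> fst X \<Longrightarrow> snd X g x \<in> fst X"
    and ext: "\<And>g. g \<in> carrier G \<Longrightarrow> snd X g \<in> extensional (fst X)"
    and one: "\<And>x. x \<in> fst X \<Longrightarrow> snd X \<one> x = x"
    and mult: "\<And>g h x. g \<in> carrier G \<Longrightarrow> h \<in> carrier G \<Longrightarrow> x \<in> fst X \<Longrightarrow>
      snd X (g \<otimes> h) x = snd X g (snd X h x)"
  shows "finite_gset G X"
proof -
  interpret group G by fact
  have bij: "snd X g \<in> Bij (fst X)" if g: "g \<in> carrier G" for g
  proof -
    have "snd X (inv g) (snd X g x) = x" "snd X g (snd X (inv g) x) = x" if "x \<in> fst X" for x
      using that g mult[of "inv g" g x] mult[of g "inv g" x] one by simp_all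
    then have "bij_betw (snd X g) (fst X) (fst X)"
      using g by (intro bij_betwI[where g = "snd X (inv g)"]) (auto intro: closed)
    then show ?thesis
      using ext[OF g] by (simp add: Bij_def)
  qed
  have "group_hom G (BijGroup (fst X)) (snd X)"
  proof (intro group_hom.intro group_hom_axioms.intro homI)
    fix g h assume gh: "g \<in> carrier G" "h \<in> carrier G"
    have "snd X (g \<otimes> h) = compose (fst X) (snd X g) (snd X h)"
      using gh by (intro extensionalityI[of _ "fst X"]) (auto simp: ext mult compose_def)
    then show "snd X (g \<otimes> h) = snd X g \<otimes>\<^bsub>BijGroup (fst X)\<^esub> snd X h"
      using gh by (simp add: BijGroup_def bij)
  next
    show "group (BijGroup (fst X))"
      by (rule group_BijGroup)
    show "snd X g \<in> carrier (BijGroup (fst X))" if "g \<in> carrier G" for g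
      using bij[OF that] by (simp add: BijGroup_def)
  qed (rule group_axioms)
  then show ?thesis
    using assms(2) by (simp add: finite_gset_def group_action_def)
qed

lemma finite_gsetD:
  fixes G (structure)
  assumes "finite_gset G X"
  shows finite_gset_group: "group G"
    and finite_gset_finite: "finite (fst X)"
    and finite_gset_closed: "\<And>g x. g \<in> carrier G \<Longrightarrow> x \<in> fst X \<Longrightarrow> snd X g x \<in> fst X"
    and finite_gset_ext: "\<And>g. g \<in> carrier G \<Longrightarrow> snd X g \<in> extensional (fst X)"
    and finite_gset_one: "\<And>x. x \<in> fst X \<Longrightarrow> snd X \<one> x = x"
    and finite_gset_mult: "\<And>g h x. g \<in> carrier G \<Longrightarrow> h \<in> carrier G \<Longrightarrow> x \<in> fst X \<Longrightarrow>
      snd X (g \<otimes> h) x = snd X g (snd X h x)"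
proof -
  interpret group_action G "fst X" "snd X"
    using assms by (simp add: finite_gset_def)
  show "group G"
    using group_hom group_hom.axioms(1) by blast
  show "finite (fst X)"
    using assms by (simp add: finite_gset_def)
  show "snd X g x \<in> fst X" if "g \<in> carrier G" "x \<in> fst X" for g x
    using element_image that by blast
  show "snd X g \<in> extensional (fst X)" if "g \<in> carrier G" for g
    using bij_prop0[OF that] by (simp add: Bij_def)
  show "snd X \<one> x = x" if "x \<in> fst X" for x
    using that id_eq_one by (metis restrict_apply')
  show "snd X (g \<otimes> h) x = snd X g (snd X h x)"
    if "g \<in> carrier G" "h \<in> carrier G" "x \<in> fst X" for g h x
    using composition_rule that by blast
qed

lemma gset_isoI:
  assumes "bij_betw h (fst X) (fst Y)"
    and "\<And>g x. g \<in> carrier G \<Longrightarrow> x \<in> fst X \<Longrightarrow> h (snd X g x) = snd Y g (h x)"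
  shows "gset_iso G X Y"
  using assms by (auto simp: gset_iso_def)

lemma gset_iso_sym:
  assumes X: "finite_gset G X" and "gset_iso G X Y"
  shows "gset_iso G Y X"
proof -
  obtain h where h: "bij_betw h (fst X) (fst Y)"
    and eq: "\<forall>g \<in> carrier G. \<forall>x \<in> fst X. h (snd X g x) = snd Y g (h x)"
    using assms(2) unfolding gset_iso_def by blast
  show ?thesis
  proof (rule gset_isoI)
    show "bij_betw (inv_into (fst X) h) (fst Y) (fst X)"
      using h by (rule bij_betw_inv_into)
    fix g y assume g: "g \<in> carrier G" and y: "y \<in> fst Y"
    then obtain x where x: "x \<in> fst X" "y = h x"
      using h by (auto simp: bij_betw_def)
    show "inv_into (fst X) h (snd Y g y) = snd X g (inv_into (fst X) h y)"
      using h x g eq finite_gset_closed[OF X g x(1)] by (metis bij_betw_inv_into_left)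
  qed
qed

lemma gset_iso_trans:
  assumes "gset_iso G X Y" and "gset_iso G Y Z"
  shows "gset_iso G X Z"
proof -
  obtain h where h: "bij_betw h (fst X) (fst Y)"
    "\<forall>g \<in> carrier G. \<forall>x \<in> fst X. h (snd X g x) = snd Y g (h x)"
    using assms(1) unfolding gset_iso_def by blast
  obtain k where k: "bij_betw k (fst Y) (fst Z)"
    "\<forall>g \<in> carrier G. \<forall>x \<in> fst Y. k (snd Y g x) = snd Z g (k x)"
    using assms(2) unfolding gset_iso_def by blast
  show ?thesis
    using bij_betw_trans[OF h(1) k(1)] bij_betwE[OF h(1)]
    by (intro gset_isoI[of "k \<circ> h"]) (simp_all add: h(2) k(2))
qed

text \<open>
  Transporting the structure along an enumeration of the underlying set shows that the classes, which
  only contain G-sets on natural numbers, are never empty.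
\<close>

lemma gset_iso_nat:
  assumes X: "finite_gset G X"
  obtains Y :: "('a, nat) gset" where "finite_gset G Y" and "gset_iso G X Y"
proof -
  note X' = finite_gsetD[OF X]
  obtain h :: "_ \<Rightarrow> nat" where h: "inj_on h (fst X)"
    using finite_imp_inj_to_nat_seg[OF X'(2)] by metis
  define Y where "Y = (h ` fst X, \<lambda>g. \<lambda>y \<in> h ` fst X. h (snd X g (inv_into (fst X) h y)))"
  have fst_Y: "fst Y = h ` fst X"
    by (simp add: Y_def)
  have snd_Y: "snd Y g (h x) = h (snd X g x)" if "x \<in> fst X" for g x
    using that h by (simp add: Y_def)
  have "finite_gset G Y"
  proof (rule finite_gsetI)
    show "snd Y g \<in> extensional (fst Y)" for g
      by (simp add: Y_def)
    show "finite (fst Y)"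
      using X'(2) by (simp add: fst_Y)
  qed (auto simp: fst_Y snd_Y X')
  moreover have "gset_iso G X Y"
    by (rule gset_isoI[of h]) (use h in \<open>auto simp: fst_Y snd_Y bij_betw_def\<close>)
  ultimately show thesis
    by (rule that)
qed


section \<open>Sums, products and the semiring of isomorphism classes\<close>

lemma finite_gset_sum:
  assumes "finite_gset G X" and "finite_gset G Y"
  shows "finite_gset G (gset_sum X Y)"
  by (rule finite_gsetI)
    (auto simp: gset_sum_def finite_gset_group[OF assms(1)] finite_gsetD(2-)[OF assms(1)]
      finite_gsetD(2-)[OF assms(2)])

lemma finite_gset_prod:
  assumes "finite_gset G X" and "finite_gset G Y"
  shows "finite_gset G (gset_prod X Y)"
  by (rule finite_gsetI)
    (auto simp: gset_prod_def finite_gset_group[OF assms(1)] finite_gsetD(2-)[OF assms(1)]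
      finite_gsetD(2-)[OF assms(2)])

lemma finite_gset_empty: "group G \<Longrightarrow> finite_gset G empty_gset"
  by (rule finite_gsetI) (auto simp: empty_gset_def)

lemma finite_gset_point: "group G \<Longrightarrow> finite_gset G point_gset"
  by (rule finite_gsetI) (auto simp: point_gset_def group.is_monoid)

lemma bij_betw_map_sum:
  assumes "bij_betw h A A'" and "bij_betw k B B'"
  shows "bij_betw (map_sum h k) (Sum_Type.Plus A B) (Sum_Type.Plus A' B')"
proof (rule bij_betwI[where g = "map_sum (inv_into A h) (inv_into B k)"])
  note mem = bij_betwE[OF assms(1)] bij_betwE[OF assms(2)]
    bij_betwE[OF bij_betw_inv_into[OF assms(1)]] bij_betwE[OF bij_betw_inv_into[OF assms(2)]]
  show "map_sum h k \<in> Sum_Type.Plus A B \<rightarrow> Sum_Type.Plus A' B'"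
    using mem by auto
  show "map_sum (inv_into A h) (inv_into B k) \<in> Sum_Type.Plus A' B' \<rightarrow> Sum_Type.Plus A B"
    using mem by auto
qed (auto simp: bij_betw_inv_into_left[OF assms(1)] bij_betw_inv_into_left[OF assms(2)]
  bij_betw_inv_into_right[OF assms(1)] bij_betw_inv_into_right[OF assms(2)])

lemma gset_iso_sum:
  assumes "gset_iso G X X'" and "gset_iso G Y Y'"
  shows "gset_iso G (gset_sum X Y) (gset_sum X' Y')"
proof -
  obtain h where h: "bij_betw h (fst X) (fst X')"
    "\<forall>g \<in> carrier G. \<forall>x \<in> fst X. h (snd X g x) = snd X' g (h x)"
    using assms(1) unfolding gset_iso_def by blast
  obtain k where k: "bij_betw k (fst Y) (fst Y')"
    "\<forall>g \<in> carrier G. \<forall>x \<in> fst Y. k (snd Y g x) = snd Y' g (k x)"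
    using assms(2) unfolding gset_iso_def by blast
  show ?thesis
    using bij_betw_map_sum[OF h(1) k(1)] bij_betwE[OF h(1)] bij_betwE[OF k(1)]
    by (intro gset_isoI[of "map_sum h k"]) (auto simp: gset_sum_def h k)
qed

lemma gset_iso_prod:
  assumes "gset_iso G X X'" and "gset_iso G Y Y'"
  shows "gset_iso G (gset_prod X Y) (gset_prod X' Y')"
proof -
  obtain h where h: "bij_betw h (fst X) (fst X')"
    "\<forall>g \<in> carrier G. \<forall>x \<in> fst X. h (snd X g x) = snd X' g (h x)"
    using assms(1) unfolding gset_iso_def by blast
  obtain k where k: "bij_betw k (fst Y) (fst Y')"
    "\<forall>g \<in> carrier G. \<forall>x \<in> fst Y. k (snd Y g x) = snd Y' g (k x)"
    using assms(2) unfolding gset_iso_def by blast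
  have "bij_betw (map_prod h k) (fst X \<times> fst Y) (fst X' \<times> fst Y')"
    using h(1) k(1) by (rule bij_betw_map_prod)
  then show ?thesis
    using bij_betwE[OF h(1)] bij_betwE[OF k(1)]
    by (intro gset_isoI[of "map_prod h k"]) (auto simp: gset_prod_def h k)
qed

text \<open>
  The two G-sets may live on different types, so neither need belong to its own class; the
  forward direction compares both with a common member.
\<close>

lemma gset_class_eq_iff:
  assumes X: "finite_gset G X" and Y: "finite_gset G Y"
  shows "gset_class G X = gset_class G Y \<longleftrightarrow> gset_iso G X Y"
proof
  assume eq: "gset_class G X = gset_class G Y"
  obtain Z :: "('a, nat) gset" where Z: "finite_gset G Z" "gset_iso G X Z"
    using gset_iso_nat[OF X] .
  then have "Z \<in> gset_class G Y"
    unfolding eq[symmetric] by (simp add: gset_class_def)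
  then have "gset_iso G Z Y"
    using gset_iso_sym[OF Y, of Z] by (simp add: gset_class_def)
  then show "gset_iso G X Y"
    using gset_iso_trans Z(2) by blast
next
  assume XY: "gset_iso G X Y"
  have "gset_iso G X Z \<longleftrightarrow> gset_iso G Y Z" for Z :: "('a, nat) gset"
    using gset_iso_trans[OF XY, of Z] gset_iso_trans[OF gset_iso_sym[OF X XY], of Z] by iprover
  then show "gset_class G X = gset_class G Y"
    by (simp add: gset_class_def)
qed

text \<open>
  The operations on classes are unions over all representatives.  Such a union collapses to a
  single value once the summand is independent of the representative.
\<close>

lemma UN_gset_class:
  assumes X: "finite_gset G X"
    and C: "\<And>Y :: ('a, nat) gset. finite_gset G Y \<Longrightarrow> gset_iso G X Y \<Longrightarrow> F Y = C"
  shows "(\<Union>Y \<in> gset_class G X. F Y) = C"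
proof -
  obtain Z :: "('a, nat) gset" where "finite_gset G Z" "gset_iso G X Z"
    using gset_iso_nat[OF X] .
  then have "Z \<in> gset_class G X"
    by (simp add: gset_class_def)
  then show ?thesis
    using C by (intro UN_constant_eq) (auto simp: gset_class_def)
qed

lemma gset_class_in_carrier:
  assumes X: "finite_gset G X"
  shows "gset_class G X \<in> carrier (gset_semiring G)"
proof -
  obtain Z :: "('a, nat) gset" where Z: "finite_gset G Z" "gset_iso G X Z"
    using gset_iso_nat[OF X] .
  then have "gset_class G X = gset_class G Z"
    using gset_class_eq_iff X by blast
  then show ?thesis
    using Z(1) unfolding gset_semiring_def partial_object.simps by blast
qed

lemma gset_semiringE:
  assumes "A \<in> carrier (gset_semiring G)"
  obtains X :: "('a, nat) gset" where "finite_gset G X" and "A = gset_class G X"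
  using assms unfolding gset_semiring_def partial_object.simps by blast

lemma gset_class_add:
  assumes X: "finite_gset G X" and Y: "finite_gset G Y"
  shows "gset_class G X \<oplus>\<^bsub>gset_semiring G\<^esub> gset_class G Y = gset_class G (gset_sum X Y)"
proof -
  have "gset_class G (gset_sum X' Y') = gset_class G (gset_sum X Y)"
    if "finite_gset G X'" "gset_iso G X X'" "finite_gset G Y'" "gset_iso G Y Y'"
    for X' Y' :: "('a, nat) gset"
    using that X Y by (metis gset_class_eq_iff finite_gset_sum gset_iso_sum)
  then show ?thesis
    unfolding gset_semiring_def by (simp add: UN_gset_class[OF X] UN_gset_class[OF Y])
qed

lemma gset_class_mult:
  assumes X: "finite_gset G X" and Y: "finite_gset G Y"
  shows "gset_class G X \<otimes>\<^bsub>gset_semiring G\<^esub> gset_class G Y = gset_class G (gset_prod X Y)"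
proof -
  have "gset_class G (gset_prod X' Y') = gset_class G (gset_prod X Y)"
    if "finite_gset G X'" "gset_iso G X X'" "finite_gset G Y'" "gset_iso G Y Y'"
    for X' Y' :: "('a, nat) gset"
    using that X Y by (metis gset_class_eq_iff finite_gset_prod gset_iso_prod)
  then show ?thesis
    unfolding gset_semiring_def by (simp add: UN_gset_class[OF X] UN_gset_class[OF Y])
qed

lemma gset_sum_assoc: "gset_iso G (gset_sum (gset_sum X Y) Z) (gset_sum X (gset_sum Y Z))"
  by (rule gset_isoI[of "case_sum (case_sum Inl (Inr \<circ> Inl)) (Inr \<circ> Inr)"],
      rule bij_betwI[where g = "case_sum (Inl \<circ> Inl) (case_sum (Inl \<circ> Inr) Inr)"])
    (auto simp: gset_sum_def)

lemma gset_sum_comm: "gset_iso G (gset_sum X Y) (gset_sum Y X)"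
  by (rule gset_isoI[of "case_sum Inr Inl"], rule bij_betwI[where g = "case_sum Inr Inl"])
    (auto simp: gset_sum_def)

lemma gset_sum_empty: "gset_iso G (gset_sum empty_gset X) X"
  by (rule gset_isoI[of "case_sum undefined id"], rule bij_betwI[where g = Inr])
    (auto simp: gset_sum_def empty_gset_def)

lemma gset_prod_assoc: "gset_iso G (gset_prod (gset_prod X Y) Z) (gset_prod X (gset_prod Y Z))"
  by (rule gset_isoI[of "\<lambda>((x, y), z). (x, (y, z))"],
      rule bij_betwI[where g = "\<lambda>(x, (y, z)). ((x, y), z)"])
    (auto simp: gset_prod_def)

lemma gset_prod_comm: "gset_iso G (gset_prod X Y) (gset_prod Y X)"
  by (rule gset_isoI[of prod.swap], rule bij_betwI[where g = prod.swap])
    (auto simp: gset_prod_def)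

lemma gset_prod_point: "gset_iso G (gset_prod point_gset X) X"
  by (rule gset_isoI[of snd], rule bij_betwI[where g = "Pair ()"])
    (auto simp: gset_prod_def point_gset_def)

lemma gset_prod_empty: "gset_iso G (gset_prod empty_gset X) empty_gset"
  by (rule gset_isoI[of undefined]) (auto simp: gset_prod_def empty_gset_def bij_betw_def)

lemma gset_prod_distrib:
  "gset_iso G (gset_prod (gset_sum X Y) Z) (gset_sum (gset_prod X Z) (gset_prod Y Z))"
  by (rule gset_isoI[of "\<lambda>(s, z). map_sum (\<lambda>x. (x, z)) (\<lambda>y. (y, z)) s"],
      rule bij_betwI[where g = "case_sum (map_prod Inl id) (map_prod Inr id)"])
    (auto simp: gset_sum_def gset_prod_def)

lemma gset_semiring_zero_one:
  "\<zero>\<^bsub>gset_semiring G\<^esub> = gset_class G empty_gset"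
  "\<one>\<^bsub>gset_semiring G\<^esub> = gset_class G point_gset"
  by (simp_all add: gset_semiring_def)

text \<open>
  Each semiring law is the image of a canonical isomorphism of G-sets.  The laws with the operands on the other
  side follow from commutativity of the product.
\<close>

lemma semiring_gset_semiring:
  assumes G: "group G"
  shows "semiring (gset_semiring G)"
proof -
  note [simp] = gset_class_add gset_class_mult finite_gset_sum finite_gset_prod
    gset_semiring_zero_one finite_gset_empty[OF G] finite_gset_point[OF G] gset_class_in_carrier
    gset_class_eq_iff
  let ?R = "gset_semiring G"
  have comm: "A \<otimes>\<^bsub>?R\<^esub> B = B \<otimes>\<^bsub>?R\<^esub> A" if "A \<in> carrier ?R" "B \<in> carrier ?R" for A B
    using that by (elim gset_semiringE) (simp add: gset_prod_comm)
  have distrib: "(A \<oplus>\<^bsub>?R\<^esub> B) \<otimes>\<^bsub>?R\<^esub> C = A \<otimes>\<^bsub>?R\<^esub> C \<oplus>\<^bsub>?R\<^esub> B \<otimes>\<^bsub>?R\<^esub> C"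
    if "A \<in> carrier ?R" "B \<in> carrier ?R" "C \<in> carrier ?R" for A B C
    using that by (elim gset_semiringE) (simp add: gset_prod_distrib)
  have closed: "A \<oplus>\<^bsub>?R\<^esub> B \<in> carrier ?R" "A \<otimes>\<^bsub>?R\<^esub> B \<in> carrier ?R" "\<zero>\<^bsub>?R\<^esub> \<in> carrier ?R" "\<one>\<^bsub>?R\<^esub> \<in> carrier ?R"
    if "A \<in> carrier ?R" "B \<in> carrier ?R" for A B
    using that by (elim gset_semiringE; simp)+
  have null: "\<zero>\<^bsub>?R\<^esub> \<otimes>\<^bsub>?R\<^esub> A = \<zero>\<^bsub>?R\<^esub>" "\<one>\<^bsub>?R\<^esub> \<otimes>\<^bsub>?R\<^esub> A = A" if "A \<in> carrier ?R" for A
    using that by (elim gset_semiringE; simp add: gset_prod_empty gset_prod_point)+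
  have "abelian_monoid ?R"
    by (rule abelian_monoidI; (elim gset_semiringE)?;
        simp add: gset_sum_assoc gset_sum_comm gset_sum_empty)
  moreover have "monoid ?R"
  proof (rule monoidI)
    show "A \<otimes>\<^bsub>?R\<^esub> \<one>\<^bsub>?R\<^esub> = A" if "A \<in> carrier ?R" for A
      using that comm null closed by metis
    show "A \<otimes>\<^bsub>?R\<^esub> B \<otimes>\<^bsub>?R\<^esub> C = A \<otimes>\<^bsub>?R\<^esub> (B \<otimes>\<^bsub>?R\<^esub> C)"
      if "A \<in> carrier ?R" "B \<in> carrier ?R" "C \<in> carrier ?R" for A B C
      using that by (elim gset_semiringE) (simp add: gset_prod_assoc)
  qed (use null closed in simp_all)
  moreover have "C \<otimes>\<^bsub>?R\<^esub> (A \<oplus>\<^bsub>?R\<^esub> B) = C \<otimes>\<^bsub>?R\<^esub> A \<oplus>\<^bsub>?R\<^esub> C \<otimes>\<^bsub>?R\<^esub> B"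
    if "A \<in> carrier ?R" "B \<in> carrier ?R" "C \<in> carrier ?R" for A B C
    using that comm closed(1) distrib by metis
  moreover have "A \<otimes>\<^bsub>?R\<^esub> \<zero>\<^bsub>?R\<^esub> = \<zero>\<^bsub>?R\<^esub>" if "A \<in> carrier ?R" for A
    using that comm null closed by metis
  ultimately show ?thesis
    using distrib null by (intro semiring.intro semiring_axioms.intro)
qed


section \<open>The Grothendieck ring and its functoriality\<close>

context abelian_monoid
begin

lemma grothendieck_relI:
  assumes "a \<in> carrier G" "b \<in> carrier G" "c \<in> carrier G" "d \<in> carrier G" "e \<in> carrier G"
    and "a \<oplus> d \<oplus> e = c \<oplus> b \<oplus> e"
  shows "((a, b), (c, d)) \<in> grothendieck_rel G"
  using assms by (auto simp: grothendieck_rel_def)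

lemma grothendieck_relE:
  assumes "((a, b), (c, d)) \<in> grothendieck_rel G"
  obtains e where "a \<in> carrier G" "b \<in> carrier G" "c \<in> carrier G" "d \<in> carrier G" "e \<in> carrier G"
    and "a \<oplus> d \<oplus> e = c \<oplus> b \<oplus> e"
  using assms by (auto simp: grothendieck_rel_def)

lemma equiv_grothendieck_rel: "equiv (carrier G \<times> carrier G) (grothendieck_rel G)"
proof (rule equivI)
  show "grothendieck_rel G \<subseteq> (carrier G \<times> carrier G) \<times> carrier G \<times> carrier G"
    by (auto simp: grothendieck_rel_def)
  show "refl_on (carrier G \<times> carrier G) (grothendieck_rel G)"
    by (auto simp: refl_on_def intro: grothendieck_relI[of _ _ _ _ \<zero>])
  show "sym (grothendieck_rel G)"
    by (auto simp: sym_def elim!: grothendieck_relE intro: grothendieck_relI)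
  show "trans (grothendieck_rel G)"
  proof (rule transI, clarify)
    fix a b c d p q
    assume "((a, b), (c, d)) \<in> grothendieck_rel G" "((c, d), (p, q)) \<in> grothendieck_rel G"
    then obtain e e' where in_G: "a \<in> carrier G" "b \<in> carrier G" "c \<in> carrier G" "d \<in> carrier G"
        "p \<in> carrier G" "q \<in> carrier G" "e \<in> carrier G" "e' \<in> carrier G"
      and eq: "a \<oplus> d \<oplus> e = c \<oplus> b \<oplus> e" "c \<oplus> q \<oplus> e' = p \<oplus> d \<oplus> e'"
      by (auto elim!: grothendieck_relE)
    have "a \<oplus> q \<oplus> (c \<oplus> d \<oplus> e \<oplus> e') = (a \<oplus> d \<oplus> e) \<oplus> (c \<oplus> q \<oplus> e')"
      using in_G by (simp add: a_ac)
    also have "\<dots> = (c \<oplus> b \<oplus> e) \<oplus> (p \<oplus> d \<oplus> e')"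
      by (simp only: eq)
    also have "\<dots> = p \<oplus> b \<oplus> (c \<oplus> d \<oplus> e \<oplus> e')"
      using in_G by (simp add: a_ac)
    finally show "((a, b), (p, q)) \<in> grothendieck_rel G"
      using in_G by (intro grothendieck_relI) auto
  qed
qed

lemma grothendieck_class_eq_iff:
  assumes "a \<in> carrier G" "b \<in> carrier G" "c \<in> carrier G" "d \<in> carrier G"
  shows "grothendieck_class G a b = grothendieck_class G c d \<longleftrightarrow>
    (\<exists>e \<in> carrier G. a \<oplus> d \<oplus> e = c \<oplus> b \<oplus> e)"
  using assms eq_equiv_class_iff[OF equiv_grothendieck_rel]
  by (simp add: grothendieck_class_def) (simp add: grothendieck_rel_def)

lemma grothendieck_class_eqI:
  assumes "((a, b), (c, d)) \<in> grothendieck_rel G"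
  shows "grothendieck_class G a b = grothendieck_class G c d"
  unfolding grothendieck_class_def using equiv_grothendieck_rel assms by (rule equiv_class_eq)

text \<open>The analogue of \<open>UN_gset_class\<close> for operations on formal differences.\<close>

lemma UN_grothendieck_class:
  assumes "a \<in> carrier G" "b \<in> carrier G"
    and "\<And>c d. ((a, b), (c, d)) \<in> grothendieck_rel G \<Longrightarrow> F c d = C"
  shows "(\<Union>(c, d) \<in> grothendieck_class G a b. F c d) = C"
proof -
  have "(a, b) \<in> grothendieck_class G a b"
    unfolding grothendieck_class_def
    using assms(1,2) by (intro equiv_class_self[OF equiv_grothendieck_rel]) auto
  then show ?thesis
    using assms(3) by (intro UN_constant_eq) (auto simp: grothendieck_class_def)
qed

lemma grothendieck_class_in_carrier:
  assumes "a \<in> carrier G" "b \<in> carrier G"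
  shows "grothendieck_class G a b \<in> carrier (grothendieck_ring G)"
  using assms by (auto simp: grothendieck_ring_def grothendieck_class_def quotient_def)

lemma grothendieck_ringE:
  assumes "U \<in> carrier (grothendieck_ring G)"
  obtains a b where "a \<in> carrier G" "b \<in> carrier G" "U = grothendieck_class G a b"
  using assms by (auto simp: grothendieck_ring_def grothendieck_class_def quotient_def)

lemma grothendieck_class_add:
  assumes ab: "a \<in> carrier G" "b \<in> carrier G" and cd: "c \<in> carrier G" "d \<in> carrier G"
  shows "grothendieck_class G a b \<oplus>\<^bsub>grothendieck_ring G\<^esub> grothendieck_class G c d
    = grothendieck_class G (a \<oplus> c) (b \<oplus> d)"
proof -
  have "grothendieck_class G (a' \<oplus> c') (b' \<oplus> d') = grothendieck_class G (a \<oplus> c) (b \<oplus> d)"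
    if "((a, b), (a', b')) \<in> grothendieck_rel G" "((c, d), (c', d')) \<in> grothendieck_rel G"
    for a' b' c' d'
  proof -
    obtain e where e: "a' \<in> carrier G" "b' \<in> carrier G" "e \<in> carrier G"
      "a \<oplus> b' \<oplus> e = a' \<oplus> b \<oplus> e"
      using \<open>((a, b), (a', b')) \<in> _\<close> by (auto elim: grothendieck_relE)
    obtain e' where e': "c' \<in> carrier G" "d' \<in> carrier G" "e' \<in> carrier G"
      "c \<oplus> d' \<oplus> e' = c' \<oplus> d \<oplus> e'"
      using \<open>((c, d), (c', d')) \<in> _\<close> by (auto elim: grothendieck_relE)
    have "(a \<oplus> c) \<oplus> (b' \<oplus> d') \<oplus> (e \<oplus> e') = (a \<oplus> b' \<oplus> e) \<oplus> (c \<oplus> d' \<oplus> e')"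
      using ab cd e(1-3) e'(1-3) by (simp add: a_ac)
    also have "\<dots> = (a' \<oplus> b \<oplus> e) \<oplus> (c' \<oplus> d \<oplus> e')"
      by (simp only: e e')
    also have "\<dots> = (a' \<oplus> c') \<oplus> (b \<oplus> d) \<oplus> (e \<oplus> e')"
      using ab cd e(1-3) e'(1-3) by (simp add: a_ac)
    finally show ?thesis
      using ab cd e e' by (intro grothendieck_class_eqI[symmetric] grothendieck_relI[of _ _ _ _ "e \<oplus> e'"]) auto
  qed
  then show ?thesis
    unfolding grothendieck_ring_def
    by (simp add: UN_grothendieck_class[OF ab] UN_grothendieck_class[OF cd])
qed

lemma abelian_group_grothendieck_ring: "abelian_group (grothendieck_ring G)"
proof (rule abelian_groupI)
  have zero: "\<zero>\<^bsub>grothendieck_ring G\<^esub> = grothendieck_class G \<zero> \<zero>"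
    by (simp add: grothendieck_ring_def)
  then show "\<zero>\<^bsub>grothendieck_ring G\<^esub> \<in> carrier (grothendieck_ring G)"
    by (simp add: grothendieck_class_in_carrier)
  fix U assume "U \<in> carrier (grothendieck_ring G)"
  then obtain a b where ab: "a \<in> carrier G" "b \<in> carrier G" and U: "U = grothendieck_class G a b"
    by (rule grothendieck_ringE)
  show "\<zero>\<^bsub>grothendieck_ring G\<^esub> \<oplus>\<^bsub>grothendieck_ring G\<^esub> U = U"
    using ab by (simp add: zero U grothendieck_class_add)
  have "grothendieck_class G b a \<oplus>\<^bsub>grothendieck_ring G\<^esub> U = \<zero>\<^bsub>grothendieck_ring G\<^esub>"
    using ab by (auto simp: zero U grothendieck_class_add grothendieck_class_eq_iff a_ac)
  then show "\<exists>V \<in> carrier (grothendieck_ring G). V \<oplus>\<^bsub>grothendieck_ring G\<^esub> U = \<zero>\<^bsub>grothendieck_ring G\<^esub>"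
    using ab grothendieck_class_in_carrier by blast
qed (auto elim!: grothendieck_ringE simp: grothendieck_class_add grothendieck_class_in_carrier a_ac)

end

context semiring
begin

text \<open>
  Without cancellation, a summand \<open>e\<close> witnessing the equivalence of two representatives of one factor is
  turned into the witness \<open>e \<otimes> x \<oplus> e \<otimes> y\<close> for their products with \<open>(x, y)\<close>.  Replacing the
  factors one after the other gives independence of both representatives.
\<close>

lemma grothendieck_class_mult:
  assumes ab: "a \<in> carrier R" "b \<in> carrier R" and cd: "c \<in> carrier R" "d \<in> carrier R"
  shows "grothendieck_class R a b \<otimes>\<^bsub>grothendieck_ring R\<^esub> grothendieck_class R c d
    = grothendieck_class R (a \<otimes> c \<oplus> b \<otimes> d) (a \<otimes> d \<oplus> b \<otimes> c)"
proof -
  have left: "grothendieck_class R (a \<otimes> x \<oplus> b \<otimes> y) (a \<otimes> y \<oplus> b \<otimes> x)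
      = grothendieck_class R (a' \<otimes> x \<oplus> b' \<otimes> y) (a' \<otimes> y \<oplus> b' \<otimes> x)"
    if "((a, b), (a', b')) \<in> grothendieck_rel R" and xy: "x \<in> carrier R" "y \<in> carrier R"
    for a' b' x y
  proof -
    obtain e where e: "a' \<in> carrier R" "b' \<in> carrier R" "e \<in> carrier R"
      "a \<oplus> b' \<oplus> e = a' \<oplus> b \<oplus> e"
      using \<open>((a, b), (a', b')) \<in> _\<close> by (auto elim: grothendieck_relE)
    have "(a \<otimes> x \<oplus> b \<otimes> y) \<oplus> (a' \<otimes> y \<oplus> b' \<otimes> x) \<oplus> (e \<otimes> x \<oplus> e \<otimes> y)
      = (a \<oplus> b' \<oplus> e) \<otimes> x \<oplus> (a' \<oplus> b \<oplus> e) \<otimes> y"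
      using ab xy e(1-3) by (simp add: l_distr a_ac)
    also have "\<dots> = (a' \<oplus> b \<oplus> e) \<otimes> x \<oplus> (a \<oplus> b' \<oplus> e) \<otimes> y"
      by (simp only: e)
    also have "\<dots> = (a' \<otimes> x \<oplus> b' \<otimes> y) \<oplus> (a \<otimes> y \<oplus> b \<otimes> x) \<oplus> (e \<otimes> x \<oplus> e \<otimes> y)"
      using ab xy e(1-3) by (simp add: l_distr a_ac)
    finally show ?thesis
      using ab xy e
      by (intro grothendieck_class_eqI grothendieck_relI[of _ _ _ _ "e \<otimes> x \<oplus> e \<otimes> y"]) auto
  qed
  have right: "grothendieck_class R (x \<otimes> c \<oplus> y \<otimes> d) (x \<otimes> d \<oplus> y \<otimes> c)
      = grothendieck_class R (x \<otimes> c' \<oplus> y \<otimes> d') (x \<otimes> d' \<oplus> y \<otimes> c')"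
    if "((c, d), (c', d')) \<in> grothendieck_rel R" and xy: "x \<in> carrier R" "y \<in> carrier R"
    for c' d' x y
  proof -
    obtain e where e: "c' \<in> carrier R" "d' \<in> carrier R" "e \<in> carrier R"
      "c \<oplus> d' \<oplus> e = c' \<oplus> d \<oplus> e"
      using \<open>((c, d), (c', d')) \<in> _\<close> by (auto elim: grothendieck_relE)
    have "(x \<otimes> c \<oplus> y \<otimes> d) \<oplus> (x \<otimes> d' \<oplus> y \<otimes> c') \<oplus> (x \<otimes> e \<oplus> y \<otimes> e)
      = x \<otimes> (c \<oplus> d' \<oplus> e) \<oplus> y \<otimes> (c' \<oplus> d \<oplus> e)"
      using cd xy e(1-3) by (simp add: r_distr a_ac)
    also have "\<dots> = x \<otimes> (c' \<oplus> d \<oplus> e) \<oplus> y \<otimes> (c \<oplus> d' \<oplus> e)"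
      by (simp only: e)
    also have "\<dots> = (x \<otimes> c' \<oplus> y \<otimes> d') \<oplus> (x \<otimes> d \<oplus> y \<otimes> c) \<oplus> (x \<otimes> e \<oplus> y \<otimes> e)"
      using cd xy e(1-3) by (simp add: r_distr a_ac)
    finally show ?thesis
      using cd xy e
      by (intro grothendieck_class_eqI grothendieck_relI[of _ _ _ _ "x \<otimes> e \<oplus> y \<otimes> e"]) auto
  qed
  have "grothendieck_class R (a' \<otimes> c' \<oplus> b' \<otimes> d') (a' \<otimes> d' \<oplus> b' \<otimes> c')
      = grothendieck_class R (a \<otimes> c \<oplus> b \<otimes> d) (a \<otimes> d \<oplus> b \<otimes> c)"
    if "((a, b), (a', b')) \<in> grothendieck_rel R" "((c, d), (c', d')) \<in> grothendieck_rel R"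
    for a' b' c' d'
    using left[OF that(1) cd] right[OF that(2)] that(1) by (auto elim!: grothendieck_relE)
  then show ?thesis
    unfolding grothendieck_ring_def
    by (simp add: UN_grothendieck_class[OF ab] UN_grothendieck_class[OF cd])
qed

lemma grothendieck_ring_mult_closed:
  assumes "U \<in> carrier (grothendieck_ring R)" "V \<in> carrier (grothendieck_ring R)"
  shows "U \<otimes>\<^bsub>grothendieck_ring R\<^esub> V \<in> carrier (grothendieck_ring R)"
  using assms
  by (auto elim!: grothendieck_ringE simp: grothendieck_class_mult grothendieck_class_in_carrier)

end

definition grothendieck_map ::
    "('d, 'n) ring_scheme \<Rightarrow> ('c \<Rightarrow> 'd) \<Rightarrow> ('c \<times> 'c) set \<Rightarrow> ('d \<times> 'd) set" where
  "grothendieck_map S p U = (\<Union>(a, b) \<in> U. grothendieck_class S (p a) (p b))"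

context
  fixes R :: "('c, 'm) ring_scheme" and S :: "('d, 'n) ring_scheme" and p
  assumes R: "semiring R" and S: "semiring S" and p: "p \<in> ring_hom R S"
begin

interpretation R: semiring R by (rule R)
interpretation S: semiring S by (rule S)

lemma grothendieck_map_class:
  assumes "a \<in> carrier R" "b \<in> carrier R"
  shows "grothendieck_map S p (grothendieck_class R a b) = grothendieck_class S (p a) (p b)"
  unfolding grothendieck_map_def
proof (rule R.UN_grothendieck_class[OF assms])
  fix c d assume "((a, b), (c, d)) \<in> grothendieck_rel R"
  then obtain e where e: "a \<in> carrier R" "b \<in> carrier R" "c \<in> carrier R" "d \<in> carrier R"
    "e \<in> carrier R" "a \<oplus>\<^bsub>R\<^esub> d \<oplus>\<^bsub>R\<^esub> e = c \<oplus>\<^bsub>R\<^esub> b \<oplus>\<^bsub>R\<^esub> e"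
    by (rule R.grothendieck_relE)
  have "p a \<oplus>\<^bsub>S\<^esub> p d \<oplus>\<^bsub>S\<^esub> p e = p (a \<oplus>\<^bsub>R\<^esub> d \<oplus>\<^bsub>R\<^esub> e)"
    using e(1-5) by (simp add: ring_hom_add[OF p])
  also have "\<dots> = p c \<oplus>\<^bsub>S\<^esub> p b \<oplus>\<^bsub>S\<^esub> p e"
    unfolding e(6) using e(1-5) by (simp add: ring_hom_add[OF p])
  finally show "grothendieck_class S (p c) (p d) = grothendieck_class S (p a) (p b)"
    using e by (intro S.grothendieck_class_eqI[symmetric] S.grothendieck_relI[of _ _ _ _ "p e"])
      (auto intro: ring_hom_closed[OF p])
qed

text \<open>
  A ring homomorphism in the sense of \<^const>\<open>ring_hom\<close> may fail to preserve zero when the target is not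
  cancellative, but the image of zero is additively idempotent, and so it vanishes in the Grothendieck ring.
\<close>

lemma grothendieck_map_ring_hom:
  "grothendieck_map S p \<in> ring_hom (grothendieck_ring R) (grothendieck_ring S)"
proof (rule ring_hom_memI)
  note simps = grothendieck_map_class R.grothendieck_class_add R.grothendieck_class_mult
    S.grothendieck_class_add S.grothendieck_class_mult S.grothendieck_class_in_carrier
    ring_hom_closed[OF p] ring_hom_add[OF p] ring_hom_mult[OF p] ring_hom_one[OF p]
  fix U V
  assume U: "U \<in> carrier (grothendieck_ring R)"
  then show "grothendieck_map S p U \<in> carrier (grothendieck_ring S)"
    by (auto elim!: R.grothendieck_ringE simp: simps)
  assume V: "V \<in> carrier (grothendieck_ring R)"
  show "grothendieck_map S p (U \<otimes>\<^bsub>grothendieck_ring R\<^esub> V)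
      = grothendieck_map S p U \<otimes>\<^bsub>grothendieck_ring S\<^esub> grothendieck_map S p V"
    "grothendieck_map S p (U \<oplus>\<^bsub>grothendieck_ring R\<^esub> V)
      = grothendieck_map S p U \<oplus>\<^bsub>grothendieck_ring S\<^esub> grothendieck_map S p V"
    using U V by (auto elim!: R.grothendieck_ringE simp: simps)
next
  have zero: "p \<zero>\<^bsub>R\<^esub> \<in> carrier S" "p \<zero>\<^bsub>R\<^esub> \<oplus>\<^bsub>S\<^esub> p \<zero>\<^bsub>R\<^esub> = p \<zero>\<^bsub>R\<^esub>"
    using ring_hom_add[OF p, of "\<zero>\<^bsub>R\<^esub>" "\<zero>\<^bsub>R\<^esub>"] by (auto intro: ring_hom_closed[OF p])
  have "grothendieck_class S \<one>\<^bsub>S\<^esub> (p \<zero>\<^bsub>R\<^esub>) = grothendieck_class S \<one>\<^bsub>S\<^esub> \<zero>\<^bsub>S\<^esub>"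
    using zero by (intro S.grothendieck_class_eqI S.grothendieck_relI[of _ _ _ _ "p \<zero>\<^bsub>R\<^esub>"])
      (auto simp: S.a_assoc)
  then show "grothendieck_map S p \<one>\<^bsub>grothendieck_ring R\<^esub> = \<one>\<^bsub>grothendieck_ring S\<^esub>"
    by (simp add: grothendieck_ring_def grothendieck_map_class ring_hom_one[OF p])
qed

text \<open>
  Injectivity of \<open>p\<close> would not suffice: the summand witnessing an equality in the Grothendieck ring of \<open>S\<close> may lie
  outside the image of \<open>p\<close>.  The hypothesis asks that it can be traded for a summand from \<open>R\<close>.
\<close>

lemma inj_on_grothendieck_map:
  assumes reflect: "\<And>a b e. a \<in> carrier R \<Longrightarrow> b \<in> carrier R \<Longrightarrow> e \<in> carrier S \<Longrightarrow>
    p a \<oplus>\<^bsub>S\<^esub> e = p b \<oplus>\<^bsub>S\<^esub> e \<Longrightarrow> \<exists>e' \<in> carrier R. a \<oplus>\<^bsub>R\<^esub> e' = b \<oplus>\<^bsub>R\<^esub> e'"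
  shows "inj_on (grothendieck_map S p) (carrier (grothendieck_ring R))"
proof (rule inj_onI)
  fix U V
  assume "U \<in> carrier (grothendieck_ring R)" "V \<in> carrier (grothendieck_ring R)"
    and eq: "grothendieck_map S p U = grothendieck_map S p V"
  then obtain a b c d where in_R: "a \<in> carrier R" "b \<in> carrier R" "c \<in> carrier R" "d \<in> carrier R"
    and UV: "U = grothendieck_class R a b" "V = grothendieck_class R c d"
    by (auto elim!: R.grothendieck_ringE)
  obtain e where "e \<in> carrier S" "p a \<oplus>\<^bsub>S\<^esub> p d \<oplus>\<^bsub>S\<^esub> e = p c \<oplus>\<^bsub>S\<^esub> p b \<oplus>\<^bsub>S\<^esub> e"
    using eq in_R by (auto simp: UV grothendieck_map_class S.grothendieck_class_eq_iff
        ring_hom_closed[OF p])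
  then obtain e' where "e' \<in> carrier R" "a \<oplus>\<^bsub>R\<^esub> d \<oplus>\<^bsub>R\<^esub> e' = c \<oplus>\<^bsub>R\<^esub> b \<oplus>\<^bsub>R\<^esub> e'"
    using reflect[of "a \<oplus>\<^bsub>R\<^esub> d" "c \<oplus>\<^bsub>R\<^esub> b" e] in_R by (auto simp: ring_hom_add[OF p])
  then show "U = V"
    using in_R by (auto simp: UV R.grothendieck_class_eq_iff)
qed

end


section \<open>Inflation and deflation of G-sets\<close>

definition inflate :: "('a \<Rightarrow> 'b) \<Rightarrow> ('b, 'c) gset \<Rightarrow> ('a, 'c) gset" where
  "inflate f X = (fst X, \<lambda>g. snd X (f g))"

definition inflate_class ::
    "('a, 'm) monoid_scheme \<Rightarrow> ('a \<Rightarrow> 'b) \<Rightarrow> ('b, nat) gset set \<Rightarrow> ('a, nat) gset set" where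
  "inflate_class G f A = (\<Union>X \<in> A. gset_class G (inflate f X))"

definition gset_fixed :: "'a set \<Rightarrow> ('a, 'c) gset \<Rightarrow> 'c set" where
  "gset_fixed N X = {x \<in> fst X. \<forall>n \<in> N. snd X n x = x}"

text \<open>
  The points fixed by the kernel of \<open>f\<close>, on which an element of \<open>H\<close> acts through any preimage under \<open>f\<close>.
  Two preimages differ by an element of the kernel, so the one picked by \<^const>\<open>inv_into\<close>
  is immaterial.
\<close>

definition deflate ::
    "('a, 'm) monoid_scheme \<Rightarrow> ('b, 'n) monoid_scheme \<Rightarrow> ('a \<Rightarrow> 'b) \<Rightarrow>
     ('a, 'c) gset \<Rightarrow> ('b, 'c) gset" where
  "deflate G H f X = (gset_fixed (kernel G H f) X,
     \<lambda>g. \<lambda>x \<in> gset_fixed (kernel G H f) X. snd X (inv_into (carrier G) f g) x)"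

context group_hom
begin

lemma finite_gset_inflate:
  assumes "finite_gset H X"
  shows "finite_gset G (inflate h X)"
  using finite_gsetD[OF assms] by (intro finite_gsetI) (auto simp: inflate_def)

lemma gset_iso_inflate: "gset_iso H X Y \<Longrightarrow> gset_iso G (inflate h X) (inflate h Y)"
  by (auto simp: gset_iso_def inflate_def)

lemma inflate_class_eq:
  assumes "finite_gset H X"
  shows "inflate_class G h (gset_class H X) = gset_class G (inflate h X)"
  unfolding inflate_class_def using assms
  by (intro UN_gset_class)
    (auto simp: gset_class_eq_iff finite_gset_inflate intro: gset_iso_inflate gset_iso_sym)

lemma inflate_class_ring_hom:
  "inflate_class G h \<in> ring_hom (gset_semiring H) (gset_semiring G)"
proof -
  note simps = inflate_class_eq finite_gset_inflate gset_class_in_carrier gset_class_add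
    gset_class_mult finite_gset_sum finite_gset_prod
  have "inflate h (gset_sum X Y) = gset_sum (inflate h X) (inflate h Y)"
    "inflate h (gset_prod X Y) = gset_prod (inflate h X) (inflate h Y)" for X Y :: "('c, nat) gset"
    by (simp_all add: inflate_def gset_sum_def gset_prod_def)
  moreover have "inflate h point_gset = point_gset"
    by (simp add: inflate_def point_gset_def)
  ultimately show ?thesis
    by (intro ring_hom_memI)
      (auto elim!: gset_semiringE simp: simps gset_semiring_zero_one finite_gset_point)
qed

lemma deflate_action:
  assumes X: "finite_gset G X" and g: "g \<in> carrier G"
    and x: "x \<in> gset_fixed (kernel G H h) X"
  shows "snd (deflate G H h X) (h g) x = snd X g x"
proof -
  define k where "k = inv_into (carrier G) h (h g)"
  have k: "k \<in> carrier G" "h k = h g"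
    using g by (auto simp: k_def inv_into_into f_inv_into_f)
  have "inv g \<otimes> k \<in> kernel G H h"
    using g k by (simp add: kernel_def)
  then have "snd X (inv g \<otimes> k) x = x"
    using x by (simp add: gset_fixed_def)
  moreover have "x \<in> fst X"
    using x by (simp add: gset_fixed_def)
  ultimately have "snd X g x = snd X (g \<otimes> (inv g \<otimes> k)) x"
    using finite_gset_mult[OF X, of g "inv g \<otimes> k" x] g k by simp
  also have "g \<otimes> (inv g \<otimes> k) = k"
    using g k by (metis G.inv_closed G.l_one G.m_assoc G.r_inv)
  finally show ?thesis
    using x by (simp add: deflate_def k_def)
qed

text \<open>
  Normality of the kernel: \<open>n g = g (inv g n g)\<close>, and the conjugate in brackets fixes \<open>x\<close>.
\<close>

lemma gset_fixed_closed:
  assumes X: "finite_gset G X" and g: "g \<in> carrier G"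
    and x: "x \<in> gset_fixed (kernel G H h) X"
  shows "snd X g x \<in> gset_fixed (kernel G H h) X"
proof -
  have x': "x \<in> fst X"
    using x by (simp add: gset_fixed_def)
  have "snd X n (snd X g x) = snd X g x" if n: "n \<in> kernel G H h" for n
  proof -
    have nG: "n \<in> carrier G"
      using n by (simp add: kernel_def)
    have "inv g \<otimes> n \<otimes> g \<in> kernel G H h"
      using n g by (auto simp: kernel_def)
    then have fix_x: "snd X (inv g \<otimes> n \<otimes> g) x = x"
      using x by (simp add: gset_fixed_def)
    have "g \<otimes> (inv g \<otimes> n \<otimes> g) = n \<otimes> g"
      using g nG by (metis G.inv_closed G.l_one G.m_assoc G.m_closed G.r_inv)
    then have "snd X n (snd X g x) = snd X (g \<otimes> (inv g \<otimes> n \<otimes> g)) x"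
      using finite_gset_mult[OF X nG g x'] by simp
    also have "\<dots> = snd X g x"
      using finite_gset_mult[OF X g _ x'] g nG fix_x by simp
    finally show ?thesis .
  qed
  then show ?thesis
    using finite_gset_closed[OF X g x'] by (simp add: gset_fixed_def)
qed

context
  assumes surj: "h ` carrier G = carrier H"
begin

lemma finite_gset_deflate:
  assumes X: "finite_gset G X"
  shows "finite_gset H (deflate G H h X)"
proof -
  note X' = finite_gsetD[OF X]
  have fst: "fst (deflate G H h X) = gset_fixed (kernel G H h) X"
    by (simp add: deflate_def)
  have in_X: "x \<in> fst X" if "x \<in> gset_fixed (kernel G H h) X" for x
    using that by (simp add: gset_fixed_def)
  show ?thesis
  proof (rule finite_gsetI)
    show "finite (fst (deflate G H h X))"
      using X'(2) by (simp add: fst gset_fixed_def)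
    fix x assume x: "x \<in> fst (deflate G H h X)"
    show "snd (deflate G H h X) \<one>\<^bsub>H\<^esub> x = x"
      using deflate_action[OF X, of \<one>] x X'(5) in_X by (simp add: fst)
    fix a assume "a \<in> carrier H"
    then obtain g where g: "g \<in> carrier G" "a = h g"
      using surj by auto
    show "snd (deflate G H h X) a x \<in> fst (deflate G H h X)"
      using deflate_action[OF X] gset_fixed_closed[OF X] g x by (simp add: fst)
    fix b assume "b \<in> carrier H"
    then obtain k where k: "k \<in> carrier G" "b = h k"
      using surj by auto
    have "a \<otimes>\<^bsub>H\<^esub> b = h (g \<otimes> k)"
      using g k by simp
    then have "snd (deflate G H h X) (a \<otimes>\<^bsub>H\<^esub> b) x = snd X (g \<otimes> k) x"
      using deflate_action[OF X, of "g \<otimes> k" x] g k x by (simp only: fst G.m_closed)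
    also have "\<dots> = snd X g (snd X k x)"
      using X'(6) g k x in_X by (simp add: fst)
    also have "\<dots> = snd (deflate G H h X) a (snd (deflate G H h X) b x)"
      using deflate_action[OF X] gset_fixed_closed[OF X] g k x by (simp add: fst)
    finally show "snd (deflate G H h X) (a \<otimes>\<^bsub>H\<^esub> b) x
      = snd (deflate G H h X) a (snd (deflate G H h X) b x)" .
  qed (auto simp: deflate_def)
qed

lemma gset_iso_deflate:
  assumes X: "finite_gset G X" and Y: "finite_gset G Y" and "gset_iso G X Y"
  shows "gset_iso H (deflate G H h X) (deflate G H h Y)"
proof -
  obtain j where j: "bij_betw j (fst X) (fst Y)"
    and eq: "\<forall>g \<in> carrier G. \<forall>x \<in> fst X. j (snd X g x) = snd Y g (j x)"
    using assms(3) unfolding gset_iso_def by blast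
  let ?N = "kernel G H h"
  have fixed_iff: "j x \<in> gset_fixed ?N Y \<longleftrightarrow> x \<in> gset_fixed ?N X" if x: "x \<in> fst X" for x
  proof -
    have "snd Y n (j x) = j x \<longleftrightarrow> snd X n x = x" if "n \<in> ?N" for n
    proof -
      have n: "n \<in> carrier G"
        using that by (simp add: kernel_def)
      show ?thesis
        using inj_on_eq_iff[OF bij_betw_imp_inj_on[OF j]] finite_gset_closed[OF X n x] x
        by (metis eq n)
    qed
    then show ?thesis
      using x bij_betwE[OF j] by (auto simp: gset_fixed_def)
  qed
  have "j ` gset_fixed ?N X = gset_fixed ?N Y"
  proof
    show "j ` gset_fixed ?N X \<subseteq> gset_fixed ?N Y"
      using fixed_iff by (auto simp: gset_fixed_def)
    show "gset_fixed ?N Y \<subseteq> j ` gset_fixed ?N X"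
    proof
      fix y assume y: "y \<in> gset_fixed ?N Y"
      then have "y \<in> j ` fst X"
        using j by (simp add: bij_betw_def gset_fixed_def)
      then show "y \<in> j ` gset_fixed ?N X"
        using fixed_iff y by auto
    qed
  qed
  moreover have "gset_fixed ?N X \<subseteq> fst X"
    by (auto simp: gset_fixed_def)
  ultimately have bij: "bij_betw j (gset_fixed ?N X) (gset_fixed ?N Y)"
    using j by (auto intro: bij_betw_subset)
  show ?thesis
  proof (rule gset_isoI)
    show "bij_betw j (fst (deflate G H h X)) (fst (deflate G H h Y))"
      using bij by (simp add: deflate_def)
    fix a x assume "a \<in> carrier H" and "x \<in> fst (deflate G H h X)"
    then obtain g where g: "g \<in> carrier G" "a = h g" and x: "x \<in> gset_fixed ?N X" "x \<in> fst X"
      using surj by (auto simp: deflate_def gset_fixed_def)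
    show "j (snd (deflate G H h X) a x) = snd (deflate G H h Y) a (j x)"
      using g x fixed_iff by (simp add: deflate_action[OF X] deflate_action[OF Y] eq)
  qed
qed

text \<open>
  The kernel acts trivially on the inflated summand, which therefore survives deflation in full and
  gets its original action back.
\<close>

lemma deflate_sum_inflate:
  assumes X: "finite_gset H X" and E: "finite_gset G E"
  shows "gset_iso H (deflate G H h (gset_sum (inflate h X) E)) (gset_sum X (deflate G H h E))"
proof -
  let ?S = "gset_sum (inflate h X) E"
  let ?N = "kernel G H h"
  have S: "finite_gset G ?S"
    by (simp add: finite_gset_sum finite_gset_inflate X E)
  have fixed: "gset_fixed ?N ?S = Sum_Type.Plus (fst X) (gset_fixed ?N E)"
    using finite_gset_one[OF X]
    by (auto simp: gset_fixed_def gset_sum_def inflate_def kernel_def)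
  have fst_E: "fst (deflate G H h E) = gset_fixed ?N E" and fixed_E: "gset_fixed ?N E \<subseteq> fst E"
    by (auto simp: deflate_def gset_fixed_def)
  show ?thesis
  proof (rule gset_isoI[of id])
    show "bij_betw id (fst (deflate G H h ?S)) (fst (gset_sum X (deflate G H h E)))"
      by (simp add: deflate_def fixed) (simp add: gset_sum_def)
    fix a x assume "a \<in> carrier H" and "x \<in> fst (deflate G H h ?S)"
    then obtain g where g: "g \<in> carrier G" "a = h g" and x: "x \<in> gset_fixed ?N ?S"
      using surj by (auto simp: deflate_def)
    have "snd (deflate G H h ?S) a x = snd ?S g x"
      using g x by (simp add: deflate_action[OF S])
    also have "\<dots> = snd (gset_sum X (deflate G H h E)) a x"
      using x fst_E fixed_E g unfolding fixed
      by (auto simp: gset_sum_def inflate_def deflate_action[OF E])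
    finally show "id (snd (deflate G H h ?S) a x) = snd (gset_sum X (deflate G H h E)) a (id x)"
      by simp
  qed
qed

text \<open>
  Deflation removes the inflation from \<open>A\<close> and \<open>B\<close> and turns the foreign summand \<open>C\<close> into one
  over \<open>H\<close>; this is the hypothesis of \<open>inj_on_grothendieck_map\<close>.
\<close>

lemma inflate_class_reflects_add:
  assumes "A \<in> carrier (gset_semiring H)" "B \<in> carrier (gset_semiring H)"
    "C \<in> carrier (gset_semiring G)"
    and eq: "inflate_class G h A \<oplus>\<^bsub>gset_semiring G\<^esub> C = inflate_class G h B \<oplus>\<^bsub>gset_semiring G\<^esub> C"
  shows "\<exists>D \<in> carrier (gset_semiring H). A \<oplus>\<^bsub>gset_semiring H\<^esub> D = B \<oplus>\<^bsub>gset_semiring H\<^esub> D"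
proof -
  obtain X Y :: "('c, nat) gset" and E :: "('a, nat) gset"
    where X: "finite_gset H X" "A = gset_class H X" and Y: "finite_gset H Y" "B = gset_class H Y"
      and E: "finite_gset G E" "C = gset_class G E"
    using assms(1-3) by (metis gset_semiringE)
  note fin = X(1) Y(1) E(1) finite_gset_sum finite_gset_inflate finite_gset_deflate
  let ?X = "gset_sum (inflate h X) E" and ?Y = "gset_sum (inflate h Y) E"
  have "gset_iso G ?X ?Y"
    using eq by (simp add: X Y E inflate_class_eq gset_class_add gset_class_eq_iff fin)
  then have "gset_iso H (deflate G H h ?X) (deflate G H h ?Y)"
    by (intro gset_iso_deflate) (simp_all add: fin)
  then have "gset_class H (deflate G H h ?X) = gset_class H (deflate G H h ?Y)"
    by (simp add: gset_class_eq_iff fin)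
  moreover have "gset_class H (deflate G H h ?X) = gset_class H (gset_sum X (deflate G H h E))"
    "gset_class H (deflate G H h ?Y) = gset_class H (gset_sum Y (deflate G H h E))"
    by (simp_all add: gset_class_eq_iff fin deflate_sum_inflate)
  ultimately have "A \<oplus>\<^bsub>gset_semiring H\<^esub> gset_class H (deflate G H h E)
    = B \<oplus>\<^bsub>gset_semiring H\<^esub> gset_class H (deflate G H h E)"
    by (simp add: X Y gset_class_add fin)
  then show ?thesis
    using gset_class_in_carrier[OF finite_gset_deflate[OF E(1)]] by blast
qed

end

end


section \<open>Inflation of coset spaces\<close>

lemma (in group) lcos_of_mem_lcosets:
  assumes "subgroup K G" and "C \<in> lcosets K" and "x \<in> C"
  shows "x \<in> carrier G" and "C = x <# K"
proof -
  obtain a where a: "a \<in> carrier G" "C = a <# K"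
    using assms(2) by (auto simp: LCOSETS_def)
  show "C = x <# K"
    using l_repr_independence[of x a K] a assms(1,3) by simp
  show "x \<in> carrier G"
    using a assms(1,3) subgroup.elemlcos_carrier[OF assms(1)] group_axioms by blast
qed

lemma (in group) finite_gset_coset_gset:
  assumes fin: "finite (carrier G)" and K: "subgroup K G"
  shows "finite_gset G (coset_gset G K)"
proof (rule finite_gsetI)
  have sub: "K \<subseteq> carrier G"
    using K by (rule subgroup.subset)
  show "group G"
    by (rule group_axioms)
  show "finite (fst (coset_gset G K))"
    using fin by (auto simp: coset_gset_def LCOSETS_def)
  fix C assume "C \<in> fst (coset_gset G K)"
  then have C: "C \<in> lcosets K"
    by (simp add: coset_gset_def)
  then obtain a where a: "a \<in> carrier G" "C = a <# K"
    by (auto simp: LCOSETS_def)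
  have closed: "g <# C \<in> lcosets K" if "g \<in> carrier G" for g
    using a that sub by (auto simp: LCOSETS_def lcos_m_assoc)
  then show "snd (coset_gset G K) g C \<in> fst (coset_gset G K)" if "g \<in> carrier G" for g
    using C that by (simp add: coset_gset_def)
  have CG: "C \<subseteq> carrier G"
    using a sub by (simp add: l_coset_subset_G)
  show "snd (coset_gset G K) \<one> C = C"
    using C CG by (simp add: coset_gset_def lcos_mult_one)
  show "snd (coset_gset G K) (g \<otimes> k) C = snd (coset_gset G K) g (snd (coset_gset G K) k C)"
    if "g \<in> carrier G" "k \<in> carrier G" for g k
    using C CG closed that by (simp add: coset_gset_def lcos_m_assoc)
qed (auto simp: coset_gset_def)

context group_hom
begin

lemma image_l_coset:
  assumes "a \<in> carrier G" and "K \<subseteq> carrier G"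
  shows "h ` (a <# K) = h a <#\<^bsub>H\<^esub> h ` K"
  using assms by (force simp: l_coset_def)

text \<open>
  If two cosets of \<open>K\<close> have the same image, then an element \<open>a\<close> of the first agrees under \<open>h\<close> with
  some \<open>c\<close> in the second.  Then \<open>inv c \<otimes> a\<close> lies in the kernel, hence in \<open>K\<close>, and
  the cosets coincide.
\<close>

lemma gset_iso_inflate_coset_gset:
  assumes surj: "h ` carrier G = carrier H"
    and K: "subgroup K G" and ker: "kernel G H h \<subseteq> K"
  shows "gset_iso G (coset_gset G K) (inflate h (coset_gset H (h ` K)))"
proof (rule gset_isoI[of "(`) h"])
  have sub: "K \<subseteq> carrier G"
    using K by (rule subgroup.subset)
  have "inj_on ((`) h) (lcosets K)"
  proof (rule inj_onI)
    fix C C' assume C: "C \<in> lcosets K" "C' \<in> lcosets K" and eq: "h ` C = h ` C'"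
    obtain a where a: "a \<in> carrier G" "C = a <# K"
      using C by (auto simp: LCOSETS_def)
    then have aC: "a \<in> C"
      using G.lcos_self K by simp
    then have "h a \<in> h ` C'"
      using eq by (metis imageI)
    then obtain c where c: "c \<in> C'" "h a = h c"
      by (rule imageE) (rule that)
    have cG: "c \<in> carrier G" and C': "C' = c <# K"
      using G.lcos_of_mem_lcosets[OF K C(2) c(1)] .
    have "inv c \<otimes> a \<in> K"
      using a cG c ker by (auto simp: kernel_def)
    then have "a \<in> c <# K"
      using subgroup.lcos_module_rev[OF K G.group_axioms cG a(1)] by simp
    then show "C = C'"
      using G.lcos_of_mem_lcosets(2)[OF K C(2), of a] C' a by simp
  qed
  moreover have "(`) h ` (lcosets K) = lcosets\<^bsub>H\<^esub> (h ` K)"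
  proof -
    have "(`) h ` (lcosets K) = (\<lambda>a. h ` (a <# K)) ` carrier G"
      by (auto simp: LCOSETS_def)
    also have "\<dots> = (\<lambda>a. h a <#\<^bsub>H\<^esub> h ` K) ` carrier G"
      using sub by (intro image_cong) (auto simp: image_l_coset)
    also have "\<dots> = lcosets\<^bsub>H\<^esub> (h ` K)"
      by (auto simp: LCOSETS_def simp flip: surj)
    finally show ?thesis .
  qed
  ultimately have bij: "bij_betw ((`) h) (lcosets K) (lcosets\<^bsub>H\<^esub> (h ` K))"
    by (simp add: bij_betw_def)
  then show "bij_betw ((`) h) (fst (coset_gset G K)) (fst (inflate h (coset_gset H (h ` K))))"
    by (simp add: coset_gset_def inflate_def)
  fix g C assume g: "g \<in> carrier G" and "C \<in> fst (coset_gset G K)"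
  then have C: "C \<in> lcosets K"
    by (simp add: coset_gset_def)
  then have "C \<subseteq> carrier G"
    by (rule subgroup.lcosets_carrier[OF K G.group_axioms])
  then show "h ` snd (coset_gset G K) g C = snd (inflate h (coset_gset H (h ` K))) g (h ` C)"
    using C g bij_betwE[OF bij] by (simp add: coset_gset_def inflate_def image_l_coset)
qed

end


section \<open>The isomorphism of partial Burnside rings\<close>

definition inflate_burnside ::
    "('a, 'm) monoid_scheme \<Rightarrow> ('a \<Rightarrow> 'b) \<Rightarrow>
     (('b, nat) gset set \<times> ('b, nat) gset set) set \<Rightarrow>
     (('a, nat) gset set \<times> ('a, nat) gset set) set" where
  "inflate_burnside G f = grothendieck_map (gset_semiring G) (inflate_class G f)"

lemma burnside_class_in_carrier:
  assumes "finite_gset G X"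
  shows "burnside_class G X \<in> carrier (burnside_ring G)"
proof -
  interpret semiring "gset_semiring G"
    using finite_gset_group[OF assms] by (rule semiring_gset_semiring)
  show ?thesis
    unfolding burnside_class_def burnside_ring_def
    using assms by (intro grothendieck_class_in_carrier) (auto intro: gset_class_in_carrier)
qed

context group_hom
begin

lemma inflate_burnside_ring_hom:
  "inflate_burnside G h \<in> ring_hom (burnside_ring H) (burnside_ring G)"
  unfolding inflate_burnside_def burnside_ring_def
  by (intro grothendieck_map_ring_hom semiring_gset_semiring inflate_class_ring_hom
      G.group_axioms H.group_axioms)

lemma inj_on_inflate_burnside:
  assumes "h ` carrier G = carrier H"
  shows "inj_on (inflate_burnside G h) (carrier (burnside_ring H))"
  unfolding inflate_burnside_def burnside_ring_def
  by (intro inj_on_grothendieck_map semiring_gset_semiring inflate_class_ring_hom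
      G.group_axioms H.group_axioms inflate_class_reflects_add[OF assms])

lemma inflate_burnside_class:
  assumes X: "finite_gset H X"
  shows "inflate_burnside G h (burnside_class H X) = burnside_class G (inflate h X)"
proof -
  have R: "semiring (gset_semiring H)" and S: "semiring (gset_semiring G)"
    by (intro semiring_gset_semiring G.group_axioms H.group_axioms)+
  have zero: "inflate_class G h \<zero>\<^bsub>gset_semiring H\<^esub> = \<zero>\<^bsub>gset_semiring G\<^esub>"
    by (simp add: gset_semiring_zero_one inflate_class_eq finite_gset_empty)
      (simp add: inflate_def empty_gset_def)
  have "\<zero>\<^bsub>gset_semiring H\<^esub> \<in> carrier (gset_semiring H)"
    by (simp add: gset_semiring_zero_one gset_class_in_carrier finite_gset_empty)
  then show ?thesis
    unfolding inflate_burnside_def burnside_class_def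
    using grothendieck_map_class[OF R S inflate_class_ring_hom gset_class_in_carrier[OF X]] X
    by (simp add: zero inflate_class_eq)
qed

lemma inflate_burnside_coset_gset:
  assumes surj: "h ` carrier G = carrier H" and fin: "finite (carrier G)" "finite (carrier H)"
    and K: "subgroup K G" and ker: "kernel G H h \<subseteq> K"
  shows "inflate_burnside G h (burnside_class H (coset_gset H (h ` K)))
    = burnside_class G (coset_gset G K)"
proof -
  have X: "finite_gset H (coset_gset H (h ` K))"
    using fin K by (intro H.finite_gset_coset_gset subgroup_img_is_subgroup)
  have "gset_class G (coset_gset G K) = gset_class G (inflate h (coset_gset H (h ` K)))"
    using gset_iso_inflate_coset_gset[OF surj K ker] G.finite_gset_coset_gset[OF fin(1) K]
      finite_gset_inflate[OF X] by (simp add: gset_class_eq_iff)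
  then show ?thesis
    unfolding inflate_burnside_class[OF X] by (simp add: burnside_class_def)
qed

end

theorem theorem5p3:
  fixes G1 :: "('a, 'm) monoid_scheme" and G2 :: "('b, 'n) monoid_scheme"
    and D :: "'a set set" and f :: "'a \<Rightarrow> 'b"
  assumes "group G1" and "finite (carrier G1)"
    and "group G2" and "finite (carrier G2)"
    and "collection G1 D"
    and "f \<in> hom G1 G2" and "f ` carrier G1 = carrier G2"
  shows "partial_burnside_ring G1 (collection_above D (kernel G1 G2 f)) \<simeq>
         partial_burnside_ring G2 ((\<lambda>H. f ` H) ` collection_above D (kernel G1 G2 f))"
proof -
  interpret group_hom G1 G2 f
    using assms by (simp add: group_hom_def group_hom_axioms_def)
  let ?B1 = "burnside_ring G1" and ?B2 = "burnside_ring G2"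
  let ?D = "collection_above D (kernel G1 G2 f)"
  let ?P1 = "partial_burnside_ring G1 ?D" and ?P2 = "partial_burnside_ring G2 ((`) f ` ?D)"
  let ?infl = "inflate_burnside G1 f"
  interpret S1: semiring "gset_semiring G1"
    using assms(1) by (rule semiring_gset_semiring)
  interpret S2: semiring "gset_semiring G2"
    using assms(3) by (rule semiring_gset_semiring)
  interpret B1: abelian_group ?B1
    unfolding burnside_ring_def by (rule S1.abelian_group_grothendieck_ring)
  interpret B2: abelian_group ?B2
    unfolding burnside_ring_def by (rule S2.abelian_group_grothendieck_ring)
  have D: "subgroup K G1" "kernel G1 G2 f \<subseteq> K" if "K \<in> ?D" for K
    using that assms(5) by (auto simp: collection_def collection_above_def)

  note hom = inflate_burnside_ring_hom
  note inj = inj_on_inflate_burnside[OF assms(7)]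
  interpret infl: group_hom "add_monoid ?B2" "add_monoid ?B1" ?infl
    using ring_hom_memE(1,3)[OF hom]
    by (intro group_hom.intro group_hom_axioms.intro homI B1.a_group B2.a_group) auto

  let ?gens2 = "{burnside_class G2 (coset_gset G2 H) | H. H \<in> (`) f ` ?D}"
  have gens2: "?gens2 \<subseteq> carrier ?B2"
    using D by (auto intro!: burnside_class_in_carrier H.finite_gset_coset_gset assms
        subgroup_img_is_subgroup)
  have "?infl ` ?gens2 = (\<lambda>K. ?infl (burnside_class G2 (coset_gset G2 (f ` K)))) ` ?D"
    by auto
  also have "\<dots> = {burnside_class G1 (coset_gset G1 H) | H. H \<in> ?D}"
    using D by (auto simp: inflate_burnside_coset_gset assms)
  finally have P1: "carrier ?P1 = ?infl ` carrier ?P2"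
    using infl.generate_img[of ?gens2] gens2 by (simp add: partial_burnside_ring_def)
  have P2: "carrier ?P2 \<subseteq> carrier ?B2"
    using B2.add.generate_incl[OF gens2] by (simp add: partial_burnside_ring_def)

  have ops: "mult ?P1 = mult ?B1" "add ?P1 = add ?B1" "one ?P1 = one ?B1"
    "mult ?P2 = mult ?B2" "add ?P2 = add ?B2" "one ?P2 = one ?B2"
    by (simp_all add: partial_burnside_ring_def)
  \<comment> \<open>The inverse is taken on the whole Burnside ring, where inflation is injective.  The product of
    two elements of the span can then be pulled back at once, before it is known to lie in the span.\<close>
  let ?j = "inv_into (carrier ?B2) ?infl"
  have j: "?j (?infl u) = u" if "u \<in> carrier ?B2" for u
    using inj that by (rule inv_into_f_f)
  have one: "\<one>\<^bsub>?B2\<^esub> \<in> carrier ?B2"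
    unfolding burnside_ring_def
    by (auto simp: grothendieck_ring_def[of "gset_semiring G2"] grothendieck_class_def quotient_def)
  have mult: "u \<otimes>\<^bsub>?B2\<^esub> v \<in> carrier ?B2" if "u \<in> carrier ?B2" "v \<in> carrier ?B2" for u v
    using that unfolding burnside_ring_def by (rule S2.grothendieck_ring_mult_closed)
  have "?j \<in> ring_iso ?P1 ?P2"
  proof (rule ring_iso_memI)
    fix x assume "x \<in> carrier ?P1"
    then obtain u where u: "u \<in> carrier ?P2" "u \<in> carrier ?B2" "x = ?infl u"
      using P1 P2 by auto
    show "?j x \<in> carrier ?P2"
      using u by (simp add: j)
    fix y assume "y \<in> carrier ?P1"
    then obtain v where v: "v \<in> carrier ?P2" "v \<in> carrier ?B2" "y = ?infl v"
      using P1 P2 by auto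
    show "?j (x \<otimes>\<^bsub>?P1\<^esub> y) = ?j x \<otimes>\<^bsub>?P2\<^esub> ?j y"
      using u v mult by (simp add: ops j flip: ring_hom_mult[OF hom])
    show "?j (x \<oplus>\<^bsub>?P1\<^esub> y) = ?j x \<oplus>\<^bsub>?P2\<^esub> ?j y"
      using u v by (simp add: ops j flip: ring_hom_add[OF hom])
  next
    show "?j \<one>\<^bsub>?P1\<^esub> = \<one>\<^bsub>?P2\<^esub>"
      using one by (simp add: ops j flip: ring_hom_one[OF hom])
    show "bij_betw ?j (carrier ?P1) (carrier ?P2)"
      unfolding P1 using P2 j
      by (intro bij_betwI[where g = ?infl]) (auto simp: subset_iff)
  qed
  then show ?thesis
    by (auto simp: is_ring_iso_def)
qed

end
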